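(* Let $n>3$ be an integer and $m=2^{n-1}+2^{n-3}$. The bipartite mixed graph $BDM^*(2,m)$ is a totally regular $(1,1,k)$-mixed graph on $N=4m=2^{n+1}+2^{n-1}$ vertices, where $k$ denotes its diameter.
   Context: A mixed graph may contain undirected edges and directed edges (arcs). The undirected degree of a vertex is the number of edges incident to it; its out-degree (in-degree) is the number of arcs leaving (entering) it. A $(1,1,k)$-mixed graph is a mixed graph with maximum undirected degree $1$, maximum out-degree $1$ and diameter $k$ (the maximum distance over ordered pairs of vertices, with edges traversable in both directions and arcs only along their orientation). It is totally regular if every vertex has undirected degree $1$, out-degree $1$ and in-degree $1$. It is bipartite if the vertex set splits into two sets such that every edge and arc joins vertices of different sets. For $m=2^{n-1}+2^{n-3}$ with $n>3$ (so $m$ is even), $BDM^*(2,m)$ has vertices $(\alpha,i)_\beta$ with $\alpha,\beta\in\{0,1\}$ and $i\in\mathbb{Z}_m=\{0,1,\dots,m-1\}$, with partite sets $V_\beta=\{(0,i)_\beta,(1,i)_\beta:i\in\mathbb{Z}_m\}$ for $\beta=0,1$. Its edges are $(0,i)_0\sim(0,i)_1$ and $(1,i)_0\sim(1,i)_1$ for all $i\in\mathbb{Z}_m$. Its arcs are (arithmetic modulo $m$): - if $i\in[0,m/2-1]$: $(0,i)_0\to(1,2i)_1$, $(0,i)_1\to(1,2i+1)_0$, $(1,i)_0\to(0,-2i-1)_1$, $(1,i)_1\to(0,-2i-2)_0$; - if $i\in[m/2,m-1]$: $(0,i)_0\to(1,2i+1)_1$, $(0,i)_1\to(1,2i)_0$,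 $(1,i)_0\to(0,-2i-2)_1$, $(1,i)_1\to(0,-2i-1)_0$. *)

theory Defs
  imports Main "HOL-Library.Extended_Nat"
begin

text \<open>A mixed graph: undirected edges are two-element sets of vertices, arcs are ordered pairs.\<close>

record 'a mixed_graph =
  verts :: "'a set"
  edges :: "'a set set"
  arcs :: "('a \<times> 'a) set"

definition is_mixed_graph :: "'a mixed_graph \<Rightarrow> bool" where
  "is_mixed_graph G \<longleftrightarrow>
     finite (verts G) \<and> verts G \<noteq> {} \<and>
     (\<forall>e\<in>edges G. e \<subseteq> verts G \<and> card e = 2) \<and>
     (\<forall>(u, v)\<in>arcs G. u \<in> verts G \<and> v \<in> verts G \<and> u \<noteq> v)"

definition undirected_degree :: "'a mixed_graph \<Rightarrow> 'a \<Rightarrow> nat" where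
  "undirected_degree G v = card {e \<in> edges G. v \<in> e}"

definition out_degree :: "'a mixed_graph \<Rightarrow> 'a \<Rightarrow> nat" where
  "out_degree G v = card {a \<in> arcs G. fst a = v}"

definition in_degree :: "'a mixed_graph \<Rightarrow> 'a \<Rightarrow> nat" where
  "in_degree G v = card {a \<in> arcs G. snd a = v}"

text \<open>One step of a walk: along an edge in either direction, or along an arc in its orientation.\<close>

definition step_rel :: "'a mixed_graph \<Rightarrow> ('a \<times> 'a) set" where
  "step_rel G = {(u, v). {u, v} \<in> edges G} \<union> arcs G"

text \<open>The distance is the least length of a walk; it is \<open>\<infinity>\<close> (the infimum of the empty set)
  if there is no walk. Hence a finite diameter includes strong connectedness.\<close>

definition distance :: "'a mixed_graph \<Rightarrow> 'a \<Rightarrow> 'a \<Rightarrow> enat" where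
  "distance G u v = Inf {enat l | l. (u, v) \<in> step_rel G ^^ l}"

definition diameter :: "'a mixed_graph \<Rightarrow> enat" where
  "diameter G = Sup {distance G u v | u v. u \<in> verts G \<and> v \<in> verts G}"

text \<open>An $(r,z,k)$-mixed graph: maximum undirected degree $r$, maximum out-degree $z$,
  (finite) diameter $k$.\<close>

definition rzk_mixed_graph :: "nat \<Rightarrow> nat \<Rightarrow> nat \<Rightarrow> 'a mixed_graph \<Rightarrow> bool" where
  "rzk_mixed_graph r z k G \<longleftrightarrow>
     is_mixed_graph G \<and>
     Max (undirected_degree G ` verts G) = r \<and>
     Max (out_degree G ` verts G) = z \<and>
     diameter G = enat k"

definition totally_regular :: "nat \<Rightarrow> nat \<Rightarrow> 'a mixed_graph \<Rightarrow> bool" where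
  "totally_regular r z G \<longleftrightarrow>
     (\<forall>v\<in>verts G. undirected_degree G v = r \<and> out_degree G v = z \<and> in_degree G v = z)"

definition bipartite_with :: "'a mixed_graph \<Rightarrow> 'a set \<Rightarrow> 'a set \<Rightarrow> bool" where
  "bipartite_with G A B \<longleftrightarrow>
     A \<union> B = verts G \<and> A \<inter> B = {} \<and>
     (\<forall>e\<in>edges G. \<exists>a\<in>A. \<exists>b\<in>B. e = {a, b}) \<and>
     (\<forall>(u, v)\<in>arcs G. u \<in> A \<and> v \<in> B \<or> u \<in> B \<and> v \<in> A)"

text \<open>The vertex $(\alpha,i)_\beta$ is the triple \<open>(\<alpha>, i, \<beta>)\<close>. The residue \<open>i\<close> is an \<open>int\<close>
  so that expressions such as $-2i-1$ are not truncated before reduction modulo \<open>m\<close>.\<close>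

type_synonym vertex = "nat \<times> int \<times> nat"

definition BDM_part :: "nat \<Rightarrow> nat \<Rightarrow> vertex set" where
  "BDM_part m \<beta> = {(\<alpha>, i, \<beta>) | \<alpha> i. \<alpha> \<in> {0, 1} \<and> i \<in> {0..int m - 1}}"

definition BDM_edges :: "nat \<Rightarrow> vertex set set" where
  "BDM_edges m = {{(\<alpha>, i, 0), (\<alpha>, i, 1)} | \<alpha> i. \<alpha> \<in> {0, 1} \<and> i \<in> {0..int m - 1}}"

definition BDM_arcs :: "nat \<Rightarrow> (vertex \<times> vertex) set" where
  "BDM_arcs m =
     (\<Union>i\<in>{0..int m div 2 - 1}.
       {((0, i, 0), (1, (2 * i) mod int m, 1)),
        ((0, i, 1), (1, (2 * i + 1) mod int m, 0)),
        ((1, i, 0), (0, (- 2 * i - 1) mod int m, 1)),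
        ((1, i, 1), (0, (- 2 * i - 2) mod int m, 0))}) \<union>
     (\<Union>i\<in>{int m div 2..int m - 1}.
       {((0, i, 0), (1, (2 * i + 1) mod int m, 1)),
        ((0, i, 1), (1, (2 * i) mod int m, 0)),
        ((1, i, 0), (0, (- 2 * i - 2) mod int m, 1)),
        ((1, i, 1), (0, (- 2 * i - 1) mod int m, 0))})"

text \<open>\<open>BDM_star m\<close> is the graph $BDM^*(2,m)$; it is intended for even \<open>m\<close>.\<close>

definition BDM_star :: "nat \<Rightarrow> vertex mixed_graph" where
  "BDM_star m =
     \<lparr>verts = BDM_part m 0 \<union> BDM_part m 1, edges = BDM_edges m, arcs = BDM_arcs m\<rparr>"

end

theory Submission
  imports Defs
begin

text \<open>The arcs are the graph of an injective map on the finite vertex set, which gives in- and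
  out-degree 1. For the finiteness of the diameter, contract the edges: \<open>(0, i)\<close> then has
  the out-neighbours \<open>(1, 2i)\<close> and \<open>(1, 2i + 1)\<close>, and \<open>(1, i)\<close> has \<open>(0, -2i - 1)\<close> and
  \<open>(0, -2i - 2)\<close>. So an interval of \<open>L\<close> consecutive residues is sent to one of \<open>2L\<close>
  consecutive residues, and after \<open>k\<close> arcs with \<open>2^k \<ge> m\<close> every residue is reached.\<close>

section \<open>Degrees and diameter in general mixed graphs\<close>

lemma out_degree_functional:
  assumes "arcs G = (\<lambda>v. (v, f v)) ` verts G" and "v \<in> verts G"
  shows "out_degree G v = 1"
proof -
  have "{a \<in> arcs G. fst a = v} = {(v, f v)}"
    using assms by auto
  then show ?thesis
    by (simp add: out_degree_def)
qed

lemma in_degree_functional: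
  assumes "arcs G = (\<lambda>v. (v, f v)) ` verts G" and "bij_betw f (verts G) (verts G)"
    and "v \<in> verts G"
  shows "in_degree G v = 1"
proof -
  obtain u where u: "u \<in> verts G" "f u = v"
    using assms(2,3) by (metis bij_betw_def imageE)
  then have "{a \<in> arcs G. snd a = v} = {(u, v)}"
    using assms by (auto simp: bij_betw_def dest: inj_onD)
  then show ?thesis
    by (simp add: in_degree_def)
qed

text \<open>There are finitely many ordered pairs and a walk bounds each distance, so the supremum
  is a maximum of finite values, or 0 if there are no vertices.\<close>

lemma diameter_finite_if_strongly_connected:
  assumes "finite (verts G)"
    and "\<And>u v. u \<in> verts G \<Longrightarrow> v \<in> verts G \<Longrightarrow> (u, v) \<in> (step_rel G)\<^sup>*"
  shows "\<exists>k. diameter G = enat k"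
proof -
  let ?D = "{distance G u v | u v. u \<in> verts G \<and> v \<in> verts G}"
  have "?D = (\<lambda>(u, v). distance G u v) ` (verts G \<times> verts G)"
    by auto
  then have fin: "finite ?D"
    using assms(1) by simp
  have "distance G u v \<noteq> \<infinity>" if uv: "u \<in> verts G" "v \<in> verts G" for u v
  proof -
    obtain l where "(u, v) \<in> step_rel G ^^ l"
      using assms(2)[OF uv] rtrancl_power by blast
    then have "distance G u v \<le> enat l"
      unfolding distance_def by (intro Inf_lower) blast
    then show ?thesis
      by (cases "distance G u v") auto
  qed
  then have D: "\<infinity> \<notin> ?D"
    by fastforce
  have "Sup ?D \<noteq> \<infinity>"
  proof (cases "?D = {}")
    case False
    then have "Sup ?D = Max ?D"
      by (simp only: Sup_enat_def False fin if_False if_True)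
    then show ?thesis
      using D Max_in[OF fin False] by metis
  qed (simp add: Sup_enat_def)
  then show ?thesis
    by (auto simp: diameter_def)
qed

text \<open>The vertex set is nonempty, so each degree function has a singleton image and
  \<open>Max\<close> returns the common value.\<close>

lemma totally_regular_imp_rzk_mixed_graph:
  assumes "is_mixed_graph G" "totally_regular r z G" "diameter G = enat k"
  shows "rzk_mixed_graph r z k G"
proof -
  have "undirected_degree G ` verts G = {r}" "out_degree G ` verts G = {z}"
    using assms(1,2) by (force simp: is_mixed_graph_def totally_regular_def)+
  then show ?thesis
    using assms by (simp add: rzk_mixed_graph_def)
qed

section \<open>The successor map and the degrees\<close>

text \<open>The bit \<open>c\<close> merges the two index ranges of the arcs. On vertices it is 0
  for the lower half with \<beta> = 0 and the upper half with \<beta> = 1, so the two ends of an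
  edge always carry different bits.\<close>

definition BDM_succ :: "nat \<Rightarrow> vertex \<Rightarrow> vertex" where
  "BDM_succ m = (\<lambda>(\<alpha>, i, \<beta>).
     let c = if (i < int m div 2) = (\<beta> = 0) then 0 else 1
     in if \<alpha> = 0 then (1, (2 * i + c) mod int m, 1 - \<beta>)
        else (0, (- 2 * i - 1 - c) mod int m, 1 - \<beta>))"

lemma verts_BDM_star:
  "verts (BDM_star m) = {0, 1} \<times> {0..<int m} \<times> {0, 1}"
  by (auto simp: BDM_star_def BDM_part_def)

lemma finite_verts_BDM_star: "finite (verts (BDM_star m))"
  by (simp add: verts_BDM_star)

lemma card_verts_BDM_star: "card (verts (BDM_star m)) = 4 * m"
  by (simp add: verts_BDM_star card_cartesian_product)

text \<open>This puts the arcs in the form that the degree lemmas for functional arc sets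
  require.\<close>

lemma arcs_BDM_star:
  "arcs (BDM_star m) = (\<lambda>v. (v, BDM_succ m v)) ` verts (BDM_star m)" (is "?A = ?B")
proof
  \<comment> \<open>These bounds place both index ranges of the arcs inside the residues.\<close>
  have "0 \<le> int m div 2" "int m div 2 \<le> int m"
    by auto
  then show "?A \<subseteq> ?B"
    by (auto simp: BDM_star_def BDM_arcs_def BDM_part_def BDM_succ_def image_iff algebra_simps)
  show "?B \<subseteq> ?A"
  proof
    fix a assume "a \<in> ?B"
    then obtain \<alpha> i \<beta> where a: "a = ((\<alpha>, i, \<beta>), BDM_succ m (\<alpha>, i, \<beta>))"
      and v: "\<alpha> \<in> {0, 1}" "0 \<le> i" "i < int m" "\<beta> \<in> {0, 1}"
      by (auto simp: verts_BDM_star)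
    show "a \<in> ?A"
    proof (cases "i < int m div 2")
      case True
      then have "i \<in> {0..int m div 2 - 1}" using v by auto
      then show ?thesis
        unfolding a using True v
        by (auto simp: BDM_star_def BDM_arcs_def BDM_succ_def algebra_simps)
    next
      case False
      then have "i \<in> {int m div 2..int m - 1}" using v by auto
      then show ?thesis
        unfolding a using False v
        by (auto simp: BDM_star_def BDM_arcs_def BDM_succ_def algebra_simps)
    qed
  qed
qed

lemma BDM_succ_in_verts:
  assumes "v \<in> verts (BDM_star m)"
  shows "BDM_succ m v \<in> verts (BDM_star m)"
  using assms by (auto simp: verts_BDM_star BDM_succ_def Let_def)

text \<open>As \<open>m\<close> is even, parity survives reduction modulo \<open>m\<close> and
  forces \<open>c = d\<close>. Then \<open>i\<close> and \<open>j\<close> lie in the same half, so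
  their doubles differ by less than \<open>m\<close>.\<close>

lemma double_plus_bit_mod_inj:
  fixes i j m c d :: int
  assumes "even m" "0 \<le> i" "i < m" "0 \<le> j" "j < m" "c \<in> {0, 1}" "d \<in> {0, 1}"
    and "(i < m div 2) = (c = b) \<longleftrightarrow> (j < m div 2) = (d = b)"
    and dvd: "m dvd (2 * i + c) - (2 * j + d)"
  shows "i = j"
proof -
  have "even ((2 * i + c) - (2 * j + d))"
    using dvd \<open>even m\<close> dvd_trans by blast
  then have cd: "c = d"
    using assms(6,7) by auto
  then have "i < m div 2 \<longleftrightarrow> j < m div 2"
    using assms(8) by blast
  moreover have "m = 2 * (m div 2)"
    using \<open>even m\<close> by simp
  ultimately have "\<bar>2 * i - 2 * j\<bar> < m"
    using assms(2-5) by linarith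
  moreover have "m dvd 2 * i - 2 * j"
    using dvd cd by simp
  ultimately show ?thesis
    using zdvd_imp_le[of m "\<bar>2 * i - 2 * j\<bar>"] by auto
qed

lemma inj_on_BDM_succ:
  assumes "even m"
  shows "inj_on (BDM_succ m) (verts (BDM_star m))"
proof (rule inj_onI)
  fix u v assume uv: "u \<in> verts (BDM_star m)" "v \<in> verts (BDM_star m)"
    and eq: "BDM_succ m u = BDM_succ m v"
  obtain \<alpha> i \<beta> where u: "u = (\<alpha>, i, \<beta>)" "\<alpha> \<in> {0, 1}" "0 \<le> i" "i < int m" "\<beta> \<in> {0, 1}"
    using uv(1) by (auto simp: verts_BDM_star)
  obtain \<alpha>' j \<beta>' where v: "v = (\<alpha>', j, \<beta>')" "\<alpha>' \<in> {0, 1}" "0 \<le> j" "j < int m" "\<beta>' \<in> {0, 1}"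
    using uv(2) by (auto simp: verts_BDM_star)
  \<comment> \<open>The successor flips both binary coordinates, so they can be read off the
    image.\<close>
  have same: "\<alpha>' = \<alpha>" "\<beta>' = \<beta>"
    using eq u v by (auto simp: BDM_succ_def Let_def split: if_splits)
  define c :: "int \<Rightarrow> int" where "c x = (if (x < int m div 2) = (\<beta> = 0) then 0 else 1)" for x
  have "int m dvd (2 * i + c i) - (2 * j + c j)"
  proof (cases "\<alpha> = 0")
    case True
    then have "(2 * i + c i) mod int m = (2 * j + c j) mod int m"
      using eq by (simp add: u(1) v(1) same BDM_succ_def Let_def c_def)
    then show ?thesis
      by (rule mod_eq_dvd_iff[THEN iffD1])
  next
    case False
    then have "(- 2 * i - 1 - c i) mod int m = (- 2 * j - 1 - c j) mod int m"
      using eq by (simp add: u(1) v(1) same BDM_succ_def Let_def c_def)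
    then have "int m dvd (- 2 * i - 1 - c i) - (- 2 * j - 1 - c j)"
      by (rule mod_eq_dvd_iff[THEN iffD1])
    then have "int m dvd - ((- 2 * i - 1 - c i) - (- 2 * j - 1 - c j))"
      by (simp only: dvd_minus_iff)
    then show ?thesis
      by (simp add: algebra_simps)
  qed
  \<comment> \<open>With \<open>b = 0\<close>, both sides of the condition on halves amount to
    \<beta> = 0.\<close>
  then have "i = j"
    using assms u v
    by (intro double_plus_bit_mod_inj[where m = "int m" and c = "c i" and d = "c j" and b = 0])
      (auto simp: c_def)
  then show "u = v"
    by (simp add: u(1) v(1) same)
qed

text \<open>An injective self-map of a finite set is onto.\<close>

lemma bij_betw_BDM_succ:
  assumes "even m"
  shows "bij_betw (BDM_succ m) (verts (BDM_star m)) (verts (BDM_star m))"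
proof -
  have "BDM_succ m ` verts (BDM_star m) = verts (BDM_star m)"
    by (rule endo_inj_surj[OF finite_verts_BDM_star _ inj_on_BDM_succ[OF assms]])
      (use BDM_succ_in_verts in blast)
  then show ?thesis
    using inj_on_BDM_succ[OF assms] by (simp add: bij_betw_def)
qed

lemma undirected_degree_BDM_star:
  assumes "v \<in> verts (BDM_star m)"
  shows "undirected_degree (BDM_star m) v = 1"
proof -
  obtain \<alpha> i \<beta> where v: "v = (\<alpha>, i, \<beta>)" "\<alpha> \<in> {0, 1}" "0 \<le> i" "i < int m" "\<beta> \<in> {0, 1}"
    using assms by (auto simp: verts_BDM_star)
  have "{e \<in> edges (BDM_star m). v \<in> e} = {{(\<alpha>, i, 0), (\<alpha>, i, 1)}}"
    using v by (auto simp: BDM_star_def BDM_edges_def)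
  then show ?thesis
    by (simp add: undirected_degree_def)
qed

lemma totally_regular_BDM_star:
  assumes "even m"
  shows "totally_regular 1 1 (BDM_star m)"
  unfolding totally_regular_def
  using undirected_degree_BDM_star out_degree_functional[OF arcs_BDM_star]
    in_degree_functional[OF arcs_BDM_star bij_betw_BDM_succ[OF assms]]
  by blast

section \<open>Bipartiteness and well-formedness\<close>

lemma bipartite_BDM_star: "bipartite_with (BDM_star m) (BDM_part m 0) (BDM_part m 1)"
proof -
  have "u \<in> BDM_part m 0 \<and> v \<in> BDM_part m 1 \<or> u \<in> BDM_part m 1 \<and> v \<in> BDM_part m 0"
    if "(u, v) \<in> arcs (BDM_star m)" for u v
  proof -
    have "u \<in> verts (BDM_star m)" "v = BDM_succ m u" "v \<in> verts (BDM_star m)"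
      using that BDM_succ_in_verts by (auto simp: arcs_BDM_star)
    then show ?thesis
      by (auto simp: verts_BDM_star BDM_part_def BDM_succ_def Let_def split: if_splits)
  qed
  moreover have "\<exists>a\<in>BDM_part m 0. \<exists>b\<in>BDM_part m 1. e = {a, b}"
    if e: "e \<in> edges (BDM_star m)" for e
  proof -
    obtain \<alpha> i where "e = {(\<alpha>, i, 0), (\<alpha>, i, 1)}" "\<alpha> \<in> {0, 1}" "i \<in> {0..int m - 1}"
      using e by (auto simp: BDM_star_def BDM_edges_def)
    then show ?thesis
      by (intro bexI[of _ "(\<alpha>, i, 0)"] bexI[of _ "(\<alpha>, i, 1)"]) (auto simp: BDM_part_def)
  qed
  moreover have "BDM_part m 0 \<union> BDM_part m 1 = verts (BDM_star m)"
    by (simp add: BDM_star_def)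
  moreover have "BDM_part m 0 \<inter> BDM_part m 1 = {}"
    by (auto simp: BDM_part_def)
  ultimately show ?thesis
    unfolding bipartite_with_def by blast
qed

lemma is_mixed_graph_BDM_star:
  assumes "m > 0"
  shows "is_mixed_graph (BDM_star m)"
proof -
  have "verts (BDM_star m) \<noteq> {}"
    using assms by (auto simp: verts_BDM_star)
  moreover have "e \<subseteq> verts (BDM_star m) \<and> card e = 2" if "e \<in> edges (BDM_star m)" for e
    using that by (auto simp: BDM_star_def BDM_edges_def BDM_part_def)
  \<comment> \<open>Every arc flips the first coordinate, which excludes loops.\<close>
  moreover have "BDM_succ m v \<noteq> v" if "v \<in> verts (BDM_star m)" for v
    using that by (auto simp: BDM_succ_def Let_def verts_BDM_star split: if_splits)
  then have "\<forall>(u, v)\<in>arcs (BDM_star m). u \<in> verts (BDM_star m) \<and> v \<in> verts (BDM_star m) \<and> u \<noteq> v"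
    unfolding arcs_BDM_star using BDM_succ_in_verts by fastforce
  ultimately show ?thesis
    using finite_verts_BDM_star by (simp add: is_mixed_graph_def)
qed

section \<open>Reachability and strong connectedness\<close>

lemma BDM_star_edge_reach:
  assumes "(\<alpha>, i, \<beta>) \<in> verts (BDM_star m)" "\<beta>' \<in> {0, 1}"
  shows "((\<alpha>, i, \<beta>), (\<alpha>, i, \<beta>')) \<in> (step_rel (BDM_star m))\<^sup>*"
proof (cases "\<beta>' = \<beta>")
  case False
  then have "{(\<alpha>, i, \<beta>), (\<alpha>, i, \<beta>')} = {(\<alpha>, i, 0), (\<alpha>, i, 1)}"
    using assms by (auto simp: verts_BDM_star)
  moreover have "{(\<alpha>, i, 0), (\<alpha>, i, 1)} \<in> edges (BDM_star m)"
    using assms(1) unfolding verts_BDM_star by (force simp: BDM_star_def BDM_edges_def)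
  ultimately have "((\<alpha>, i, \<beta>), (\<alpha>, i, \<beta>')) \<in> step_rel (BDM_star m)"
    by (simp add: step_rel_def)
  then show ?thesis ..
qed simp

text \<open>Walking along the edge first allows a free choice of the bit \<open>b\<close>, and a
  final edge adjusts the partite set. The integer \<open>x\<close> is left unreduced so that
  intervals may wrap around modulo \<open>m\<close>.\<close>

lemma BDM_star_arc_reach:
  fixes x b :: int
  assumes "m > 0" "\<alpha> \<in> {0, 1}" "\<beta> \<in> {0, 1}" "\<beta>' \<in> {0, 1}" "b \<in> {0, 1}"
  defines "y \<equiv> if \<alpha> = 0 then 2 * x + b else - 2 * x - 1 - b"
  shows "((\<alpha>, x mod int m, \<beta>), (1 - \<alpha>, y mod int m, \<beta>')) \<in> (step_rel (BDM_star m))\<^sup>*"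
proof -
  define i where "i = x mod int m"
  \<comment> \<open>The end of the edge whose outgoing arc carries the bit \<open>b\<close>.\<close>
  define \<gamma> :: nat where "\<gamma> = (if (i < int m div 2) = (b = 0) then 0 else 1)"
  have verts: "(\<alpha>, i, \<beta>) \<in> verts (BDM_star m)" "(\<alpha>, i, \<gamma>) \<in> verts (BDM_star m)"
    using assms by (auto simp: verts_BDM_star i_def \<gamma>_def)
  have bit: "(if (i < int m div 2) = (\<gamma> = 0) then 0 else 1) = b"
    using assms(5) by (auto simp: \<gamma>_def)
  have "(2 * i + b) mod int m = (2 * x + b) mod int m"
    unfolding i_def by (metis mod_add_left_eq mod_mult_right_eq)
  moreover have "(- 2 * i - 1 - b) mod int m = (- 2 * x - 1 - b) mod int m"
    unfolding i_def by (intro mod_diff_cong mod_mult_cong) simp_all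
  ultimately have succ: "BDM_succ m (\<alpha>, i, \<gamma>) = (1 - \<alpha>, y mod int m, 1 - \<gamma>)"
    using assms(2) bit by (auto simp: BDM_succ_def Let_def y_def)
  have "((\<alpha>, i, \<beta>), (\<alpha>, i, \<gamma>)) \<in> (step_rel (BDM_star m))\<^sup>*"
    using BDM_star_edge_reach[OF verts(1)] by (simp add: \<gamma>_def)
  also have "((\<alpha>, i, \<gamma>), BDM_succ m (\<alpha>, i, \<gamma>)) \<in> step_rel (BDM_star m)"
    using verts(2) by (simp add: step_rel_def arcs_BDM_star)
  also have "(BDM_succ m (\<alpha>, i, \<gamma>), (1 - \<alpha>, y mod int m, \<beta>')) \<in> (step_rel (BDM_star m))\<^sup>*"
    unfolding succ
    using BDM_star_edge_reach BDM_succ_in_verts[OF verts(2)] assms(4) by (simp add: succ)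
  finally show ?thesis
    by (simp add: i_def)
qed

text \<open>Induction on the number of arcs: each arc doubles the interval of reached residues, and
  only its starting point \<open>c\<close> depends on the path of signs.\<close>

lemma BDM_star_reach_interval:
  assumes v: "(\<alpha>, i, \<beta>) \<in> verts (BDM_star m)" and "m > 0"
  shows "\<exists>c. \<forall>d \<beta>'. 0 \<le> d \<longrightarrow> d < 2 ^ k \<longrightarrow> \<beta>' \<in> {0, 1} \<longrightarrow>
    ((\<alpha>, i, \<beta>), ((\<alpha> + k) mod 2, (c + d) mod int m, \<beta>')) \<in> (step_rel (BDM_star m))\<^sup>*"
proof (induction k)
  case 0
  have "\<alpha> mod 2 = \<alpha>" "i mod int m = i"
    using v by (auto simp: verts_BDM_star)
  moreover have "d = 0" if "0 \<le> d" "d < 2 ^ 0" for d :: int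
    using that by simp
  ultimately show ?case
    using BDM_star_edge_reach[OF v] by (metis add_0_right)
next
  case (Suc k)
  let ?\<gamma> = "(\<alpha> + k) mod 2"
  from Suc obtain c where c: "\<And>d \<beta>'. \<lbrakk>0 \<le> d; d < 2 ^ k; \<beta>' \<in> {0, 1}\<rbrakk> \<Longrightarrow>
      ((\<alpha>, i, \<beta>), (?\<gamma>, (c + d) mod int m, \<beta>')) \<in> (step_rel (BDM_star m))\<^sup>*"
    by blast
  have \<gamma>: "?\<gamma> \<in> {0, 1}" "(\<alpha> + Suc k) mod 2 = 1 - ?\<gamma>"
    by auto presburger+
  \<comment> \<open>The least element of the image interval. In the second case it is attained at
    offset \<open>2 ^ k - 1\<close> with bit 1.\<close>
  define c' where "c' = (if ?\<gamma> = 0 then 2 * c else - 2 * c - 2 ^ Suc k)"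
  have "((\<alpha>, i, \<beta>), (1 - ?\<gamma>, (c' + d) mod int m, \<beta>')) \<in> (step_rel (BDM_star m))\<^sup>*"
    if d: "0 \<le> d" "d < 2 ^ Suc k" and \<beta>': "\<beta>' \<in> {0, 1}" for d \<beta>'
  proof -
    \<comment> \<open>\<open>x \<mapsto> -2x - 1 - b\<close> reverses the order, so for \<open>\<gamma> = 1\<close> the offset is counted from the top.\<close>
    define d' where "d' = (if ?\<gamma> = 0 then d else 2 ^ Suc k - 1 - d)"
    \<comment> \<open>The quotient selects the residue in the old interval, the remainder the bit of
      the arc.\<close>
    have d': "0 \<le> d' div 2" "d' div 2 < 2 ^ k" "d' mod 2 \<in> {0, 1}"
      using d by (auto simp: d'_def)
    have y: "c' + d = (if ?\<gamma> = 0 then 2 * (c + d' div 2) + d' mod 2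
                       else - 2 * (c + d' div 2) - 1 - d' mod 2)"
      using div_mult_mod_eq[of d' 2] by (simp add: c'_def d'_def algebra_simps)
    show ?thesis
      unfolding y
      by (rule rtrancl_trans[OF c[OF d'(1,2), of 0] BDM_star_arc_reach])
        (use \<open>m > 0\<close> \<gamma> \<beta>' d' in auto)
  qed
  then show ?case
    unfolding \<gamma>(2) by blast
qed

lemma BDM_star_strongly_connected:
  assumes u: "u \<in> verts (BDM_star m)" and v: "v \<in> verts (BDM_star m)"
  shows "(u, v) \<in> (step_rel (BDM_star m))\<^sup>*"
proof -
  obtain \<alpha> i \<beta> where u': "u = (\<alpha>, i, \<beta>)"
    by (cases u)
  obtain \<gamma> j \<beta>' where v': "v = (\<gamma>, j, \<beta>')" "\<gamma> \<in> {0, 1}" "0 \<le> j" "j < int m" "\<beta>' \<in> {0, 1}"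
    using v by (auto simp: verts_BDM_star)
  then have "m > 0"
    by auto
  \<comment> \<open>The summands \<alpha> and \<gamma> make the parity of \<alpha> +
    \<open>k\<close> equal to \<gamma>; the even summand \<open>2 * m\<close> makes
    \<open>2 ^ k\<close> exceed \<open>m\<close>.\<close>
  define k where "k = 2 * m + \<alpha> + \<gamma>"
  obtain c where c: "\<And>d \<beta>'. \<lbrakk>0 \<le> d; d < 2 ^ k; \<beta>' \<in> {0, 1}\<rbrakk> \<Longrightarrow>
      (u, ((\<alpha> + k) mod 2, (c + d) mod int m, \<beta>')) \<in> (step_rel (BDM_star m))\<^sup>*"
    using BDM_star_reach_interval[of \<alpha> i \<beta> m k] u \<open>m > 0\<close> unfolding u' by blast
  \<comment> \<open>The offset of the target residue from the start of the interval.\<close>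
  define d where "d = (j - c) mod int m"
  have "(\<alpha> + k) mod 2 = \<gamma>"
    using v'(2) unfolding k_def by auto
  moreover have "(c + d) mod int m = j"
    using v'(3,4) by (simp add: d_def mod_add_right_eq)
  moreover have "d < 2 ^ k"
  proof -
    have "m \<le> k"
      by (simp add: k_def)
    then have "m < 2 ^ k"
      using less_exp[of k] by linarith
    then have "int m < 2 ^ k"
      by (metis of_nat_less_iff of_nat_numeral of_nat_power)
    moreover have "d < int m"
      using \<open>m > 0\<close> by (simp add: d_def)
    ultimately show ?thesis
      by linarith
  qed
  moreover have "0 \<le> d"
    using \<open>m > 0\<close> by (simp add: d_def)
  ultimately show ?thesis
    using c[of d \<beta>'] v' by simp
qed

theorem lemma3p4:
  fixes n m :: nat
  assumes "n > 3"
    and "m = 2 ^ (n - 1) + 2 ^ (n - 3)"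
  shows "bipartite_with (BDM_star m) (BDM_part m 0) (BDM_part m 1) \<and>
         totally_regular 1 1 (BDM_star m) \<and>
         (\<exists>k. rzk_mixed_graph 1 1 k (BDM_star m)) \<and>
         card (verts (BDM_star m)) = 4 * m \<and>
         4 * m = 2 ^ (n + 1) + 2 ^ (n - 1)"
proof -
  \<comment> \<open>Since \<open>n > 3\<close>, both exponents are positive.\<close>
  have m: "even m" "m > 0"
    using assms by auto
  have reg: "totally_regular 1 1 (BDM_star m)"
    by (rule totally_regular_BDM_star[OF m(1)])
  obtain k where "diameter (BDM_star m) = enat k"
    using diameter_finite_if_strongly_connected[OF finite_verts_BDM_star]
      BDM_star_strongly_connected by blast
  then have "rzk_mixed_graph 1 1 k (BDM_star m)"
    by (rule totally_regular_imp_rzk_mixed_graph[OF is_mixed_graph_BDM_star[OF m(2)] reg])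
  moreover have "4 * m = 2 ^ (n + 1) + 2 ^ (n - 1)"
  proof -
    \<comment> \<open>This removes the truncated subtractions from the exponents.\<close>
    obtain p where "n = p + 3"
      using assms(1) by (metis add.commute less_imp_add_positive)
    then show ?thesis
      by (simp add: assms(2) eval_nat_numeral)
  qed
  ultimately show ?thesis
    using bipartite_BDM_star reg card_verts_BDM_star by blast
qed

end
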